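(* Let $w\in\widehat W$ be an admissible element, let $I_w\subset\Delta^+$ be the corresponding $\mathsf{ad}$-nilpotent ideal, and let $\gamma\in I_w$. Then $\gamma$ is a generator of $I_w$ if and only if $w(\delta-\gamma)\in-\widehat\Pi$.
   Context: Let $\Delta$ be the (reduced, irreducible, crystallographic) root system of a simple Lie algebra $\mathfrak g$ of rank $p$, with Weyl group $W$, positive roots $\Delta^+$, simple roots $\Pi=\{\alpha_1,\dots,\alpha_p\}$ and highest root $\theta$. Let $V=\bigoplus_{i=1}^p\mathbb Q\alpha_i$ with a $W$-invariant inner product $(\ ,\ )$. An $\mathsf{ad}$-nilpotent ideal is a subset $I\subset\Delta^+$ such that $\gamma\in I$, $\nu\in\Delta^+$, $\gamma+\nu\in\Delta$ imply $\gamma+\nu\in I$ (these are the sets of roots of the ideals of the Borel subalgebra $\mathfrak b$ contained in $[\mathfrak b,\mathfrak b]$). An element $\gamma\in I$ is a generator of $I$ if $\gamma-\alpha\notin I$ for all $\alpha\in\Delta^+$. Affine notation: $\widehat V=V\oplus\mathbb Q\delta\oplus\mathbb Q\lambda$, with $(\ ,\ )$ extended by $(\delta,V)=(\lambda,V)=(\delta,\delta)=(\lambda,\lambda)=0$, $(\delta,\lambda)=1$. The set of affine real roots is $\widehat\Delta=\{\beta+k\delta\mid\beta\in\Delta,\ k\in\mathbb Z\}$, with positive roots $\widehat\Delta^+=\Delta^+\cup\{\beta+k\delta\mid\beta\in\Delta,\ k\ge1\}$ and simple roots $\widehat\Pi=\Pi\cup\{\alpha_0\}$, $\alpha_0=\delta-\theta$.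 The affine Weyl group $\widehat W$ is generated by the reflections $s_0,\dots,s_p$ of $\widehat V$ in $\alpha_0,\dots,\alpha_p$. Put $\widehat N(w)=\{\alpha\in\widehat\Delta^+\mid w(\alpha)\in-\widehat\Delta^+\}$. An element $w\in\widehat W$ is admissible if (a) $w(\alpha)\in\widehat\Delta^+$ for all $\alpha\in\Pi$, and (b) whenever $\alpha\in\widehat\Pi$ and $w^{-1}(\alpha)\in-\widehat\Delta^+$, one has $w^{-1}(\alpha)=\gamma-\delta$ for some $\gamma\in\Delta^+$. For admissible $w$, put $I_w=\{\gamma\in\Delta^+\mid\delta-\gamma\in\widehat N(w)\}$; by a result of Cellini and Papi, $w\mapsto I_w$ is a bijection from admissible elements onto $\mathsf{ad}$-nilpotent ideals. *)

theory Defs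
  imports Complex_Main "HOL-Library.Product_Plus"
begin

locale rat_inner_product_space = vector_space scale
  for scale :: "rat \<Rightarrow> 'v::ab_group_add \<Rightarrow> 'v" +
  fixes form :: "'v \<Rightarrow> 'v \<Rightarrow> rat"
  assumes form_add_left: "form (x + y) z = form x z + form y z"
    and form_scale_left: "form (scale c x) z = c * form x z"
    and form_commute: "form x y = form y x"
    and form_pos: "x \<noteq> 0 \<Longrightarrow> 0 < form x x"

text \<open>
  The reflections are the orthogonal ones for the given inner product, so that the inner product
  is automatically invariant under the Weyl group they generate.
\<close>

locale irreducible_root_system = rat_inner_product_space scale form
  for scale :: "rat \<Rightarrow> 'v::ab_group_add \<Rightarrow> 'v" and form :: "'v \<Rightarrow> 'v \<Rightarrow> rat" +
  fixes \<Delta> :: "'v set"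
  assumes finite_roots: "finite \<Delta>"
    and roots_nonempty: "\<Delta> \<noteq> {}"
    and zero_not_root: "0 \<notin> \<Delta>"
    and roots_span: "span \<Delta> = UNIV"
    and reflect_root:
      "\<lbrakk>\<alpha> \<in> \<Delta>; \<beta> \<in> \<Delta>\<rbrakk> \<Longrightarrow> \<beta> - scale (2 * form \<beta> \<alpha> / form \<alpha> \<alpha>) \<alpha> \<in> \<Delta>"
    and crystallographic:
      "\<lbrakk>\<alpha> \<in> \<Delta>; \<beta> \<in> \<Delta>\<rbrakk> \<Longrightarrow> 2 * form \<beta> \<alpha> / form \<alpha> \<alpha> \<in> \<int>"
    and reduced: "\<lbrakk>\<alpha> \<in> \<Delta>; scale c \<alpha> \<in> \<Delta>\<rbrakk> \<Longrightarrow> c = 1 \<or> c = - 1"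
    and irreducible:
      "\<lbrakk>\<Delta> = A \<union> B; A \<inter> B = {}; \<And>\<alpha> \<beta>. \<alpha> \<in> A \<Longrightarrow> \<beta> \<in> B \<Longrightarrow> form \<alpha> \<beta> = 0\<rbrakk>
        \<Longrightarrow> A = {} \<or> B = {}"

context vector_space
begin

definition nonneg_cone :: "'b set \<Rightarrow> 'b set"
  where "nonneg_cone S = {\<Sum>\<alpha>\<in>S. of_nat (n \<alpha>) *s \<alpha> | n :: 'b \<Rightarrow> nat. True}"

end

locale based_root_system = irreducible_root_system scale form \<Delta>
  for scale :: "rat \<Rightarrow> 'v::ab_group_add \<Rightarrow> 'v" and form :: "'v \<Rightarrow> 'v \<Rightarrow> rat"
    and \<Delta> :: "'v set" +
  fixes \<Pi> :: "'v set" and \<theta> :: 'v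
  assumes simple_roots_subset: "\<Pi> \<subseteq> \<Delta>"
    and simple_roots_independent: "independent \<Pi>"
    and root_pos_or_neg: "\<beta> \<in> \<Delta> \<Longrightarrow> \<beta> \<in> nonneg_cone \<Pi> \<or> - \<beta> \<in> nonneg_cone \<Pi>"
    and highest_root_root: "\<theta> \<in> \<Delta>"
    and highest_root_max: "\<beta> \<in> \<Delta> \<Longrightarrow> \<theta> - \<beta> \<in> nonneg_cone \<Pi>"
begin

definition pos_roots :: "'v set"
  where "pos_roots = \<Delta> \<inter> nonneg_cone \<Pi>"

definition ad_nilpotent_ideal :: "'v set \<Rightarrow> bool"
  where "ad_nilpotent_ideal I \<longleftrightarrow>
    I \<subseteq> pos_roots \<and> (\<forall>\<gamma>\<in>I. \<forall>\<nu>\<in>pos_roots. \<gamma> + \<nu> \<in> \<Delta> \<longrightarrow> \<gamma> + \<nu> \<in> I)"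

definition is_generator :: "'v set \<Rightarrow> 'v \<Rightarrow> bool"
  where "is_generator I \<gamma> \<longleftrightarrow> \<gamma> \<in> I \<and> (\<forall>\<alpha>\<in>pos_roots. \<gamma> - \<alpha> \<notin> I)"

end

text \<open>
  A triple \<open>(v, k, l)\<close> stands for the vector \<open>v + k \<delta> + l \<lambda>\<close>.
\<close>

type_synonym 'v affine = "'v \<times> rat \<times> rat"

definition fin :: "'v \<Rightarrow> 'v affine"
  where "fin v = (v, 0, 0)"

definition \<delta> :: "'v::zero affine"
  where "\<delta> = (0, 1, 0)"

context rat_inner_product_space
begin

fun affine_scale :: "rat \<Rightarrow> 'v affine \<Rightarrow> 'v affine"
  where "affine_scale c (v, k, l) = (scale c v, c * k, c * l)"

fun affine_form :: "'v affine \<Rightarrow> 'v affine \<Rightarrow> rat"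
  where "affine_form (v, k, l) (v', k', l') = form v v' + k * l' + l * k'"

definition reflection :: "'v affine \<Rightarrow> 'v affine \<Rightarrow> 'v affine"
  where "reflection a x = x - affine_scale (2 * affine_form x a / affine_form a a) a"

end

context based_root_system
begin

definition affine_roots :: "'v affine set"
  where "affine_roots = {fin \<beta> + affine_scale (of_int k) \<delta> | \<beta> k. \<beta> \<in> \<Delta>}"

definition affine_pos_roots :: "'v affine set"
  where "affine_pos_roots =
    fin ` pos_roots \<union> {fin \<beta> + affine_scale (of_int k) \<delta> | \<beta> k. \<beta> \<in> \<Delta> \<and> k \<ge> 1}"

definition affine_simple_roots :: "'v affine set"
  where "affine_simple_roots = insert (\<delta> - fin \<theta>) (fin ` \<Pi>)"

text \<open>
  Reflections are involutions, so the group they generate consists of their finite products.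
\<close>

inductive_set affine_weyl_group :: "('v affine \<Rightarrow> 'v affine) set"
  where
    weyl_id: "id \<in> affine_weyl_group"
  | weyl_step: "\<lbrakk>a \<in> affine_simple_roots; w \<in> affine_weyl_group\<rbrakk>
      \<Longrightarrow> reflection a \<circ> w \<in> affine_weyl_group"

definition inversions :: "('v affine \<Rightarrow> 'v affine) \<Rightarrow> 'v affine set"
  where "inversions w = {x \<in> affine_pos_roots. w x \<in> uminus ` affine_pos_roots}"

definition admissible :: "('v affine \<Rightarrow> 'v affine) \<Rightarrow> bool"
  where "admissible w \<longleftrightarrow>
    w \<in> affine_weyl_group \<and>
    (\<forall>\<alpha>\<in>\<Pi>. w (fin \<alpha>) \<in> affine_pos_roots) \<and>
    (\<forall>a\<in>affine_simple_roots. inv w a \<in> uminus ` affine_pos_roots \<longrightarrow>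
      (\<exists>\<gamma>\<in>pos_roots. inv w a = fin \<gamma> - \<delta>))"

definition ideal_of :: "('v affine \<Rightarrow> 'v affine) \<Rightarrow> 'v set"
  where "ideal_of w = {\<gamma> \<in> pos_roots. \<delta> - fin \<gamma> \<in> inversions w}"

lemma form_minus_left: "form (- x) y = - form x y"
  using form_add_left[of "- x" x y] form_add_left[of 0 0 y] by simp

lemma form_diff_left: "form (x - y) z = form x z - form y z"
  using form_add_left[of x "- y" z] by (simp add: form_minus_left)

lemma affine_form_add_left: "affine_form (x + y) z = affine_form x z + affine_form y z"
  by (cases x; cases y; cases z) (simp add: form_add_left algebra_simps)

lemma affine_form_scale_left: "affine_form (affine_scale c x) z = c * affine_form x z"
  by (cases x; cases z) (simp add: form_scale_left algebra_simps)

lemma affine_scale_add: "affine_scale (c + d) x = affine_scale c x + affine_scale d x"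
  by (cases x) (simp add: algebra_simps)

lemma reflection_add: "reflection a (x + y) = reflection a x + reflection a y"
  by (simp add: reflection_def affine_form_add_left affine_scale_add add_divide_distrib
      distrib_left)

lemma uminus_root:
  assumes "\<alpha> \<in> \<Delta>"
  shows "- \<alpha> \<in> \<Delta>"
proof -
  have "form \<alpha> \<alpha> \<noteq> 0"
    using assms zero_not_root form_pos[of \<alpha>] by force
  moreover have "\<alpha> - scale 2 \<alpha> = - \<alpha>"
    using scale_left_distrib[of 1 1 \<alpha>] by simp
  ultimately show ?thesis
    using reflect_root[OF assms assms] by simp
qed

lemma affine_root_iff:
  "x \<in> affine_roots \<longleftrightarrow> (\<exists>\<beta> k. \<beta> \<in> \<Delta> \<and> x = (\<beta>, of_int k, 0))"
  by (auto simp: affine_roots_def fin_def \<delta>_def)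

lemma affine_pos_root_iff:
  "x \<in> affine_pos_roots \<longleftrightarrow>
    (\<exists>\<beta> k. \<beta> \<in> \<Delta> \<and> x = (\<beta>, of_int k, 0) \<and> (k \<ge> 1 \<or> k = 0 \<and> \<beta> \<in> nonneg_cone \<Pi>))"
proof -
  have "x \<in> affine_pos_roots" if "\<beta> \<in> \<Delta>" "x = (\<beta>, 0, 0)" "\<beta> \<in> nonneg_cone \<Pi>" for \<beta>
    using that by (auto simp: affine_pos_roots_def pos_roots_def fin_def)
  then show ?thesis
    by (auto simp: affine_pos_roots_def pos_roots_def fin_def \<delta>_def)
qed

lemma affine_simple_roots_subset: "affine_simple_roots \<subseteq> affine_roots"
  using simple_roots_subset uminus_root[OF highest_root_root]
  by (auto simp: affine_simple_roots_def affine_root_iff fin_def \<delta>_def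
      intro: exI[of _ "0::int"] exI[of _ "1::int"])

lemma affine_root_nonisotropic:
  assumes "a \<in> affine_roots"
  shows "affine_form a a \<noteq> 0"
  using assms form_pos zero_not_root by (auto simp: affine_root_iff) (metis less_irrefl)

lemma reflection_involution:
  assumes "a \<in> affine_roots"
  shows "reflection a (reflection a x) = x"
proof -
  define c where "c = 2 * affine_form x a / affine_form a a"
  have "affine_scale (- d) y = - affine_scale d y" for d y
    by (cases y) simp
  then have "reflection a (x - affine_scale c a) = x - affine_scale c a -
      affine_scale (2 * affine_form (x + affine_scale (- c) a) a / affine_form a a) a"
    by (simp add: reflection_def)
  also have "2 * affine_form (x + affine_scale (- c) a) a / affine_form a a = - c"
    using affine_root_nonisotropic[OF assms]
    by (simp add: affine_form_add_left affine_form_scale_left c_def field_simps)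
  finally show ?thesis
    using \<open>\<And>d y. affine_scale (- d) y = - affine_scale d y\<close>
    by (simp add: reflection_def c_def)
qed

lemma affine_weyl_bij: "w \<in> affine_weyl_group \<Longrightarrow> bij w"
proof (induction rule: affine_weyl_group.induct)
  case weyl_id
  show ?case by (rule bij_id)
next
  case (weyl_step a w)
  then have "bij (reflection a)"
    using reflection_involution affine_simple_roots_subset by (blast intro: involuntory_imp_bij)
  with weyl_step show ?case by (intro bij_comp)
qed

lemma reflection_affine_root:
  assumes "a \<in> affine_roots" and "x \<in> affine_roots"
  shows "reflection a x \<in> affine_roots"
proof -
  obtain \<alpha> k \<beta> m where a: "\<alpha> \<in> \<Delta>" "a = (\<alpha>, of_int k, 0)" and x: "\<beta> \<in> \<Delta>" "x = (\<beta>, of_int m, 0)"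
    using assms by (auto simp: affine_root_iff)
  obtain c where c: "2 * form \<beta> \<alpha> / form \<alpha> \<alpha> = of_int c"
    using crystallographic[OF a(1) x(1)] by (auto elim: Ints_cases)
  have "reflection a x = (\<beta> - scale (of_int c) \<alpha>, of_int (m - c * k), 0)"
    using a x c by (simp add: reflection_def)
  moreover have "\<beta> - scale (of_int c) \<alpha> \<in> \<Delta>"
    using reflect_root[OF a(1) x(1)] c by simp
  ultimately show ?thesis
    using affine_root_iff by blast
qed

lemma affine_weyl_add: "w \<in> affine_weyl_group \<Longrightarrow> w (x + y) = w x + w y"
  by (induction rule: affine_weyl_group.induct) (simp_all add: reflection_add)

lemma affine_weyl_root:
  "w \<in> affine_weyl_group \<Longrightarrow> x \<in> affine_roots \<Longrightarrow> w x \<in> affine_roots"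
  by (induction rule: affine_weyl_group.induct)
    (use affine_simple_roots_subset in \<open>auto simp: reflection_affine_root\<close>)

lemma nonneg_cone_add:
  assumes "x \<in> nonneg_cone S" and "y \<in> nonneg_cone S"
  shows "x + y \<in> nonneg_cone S"
proof -
  obtain m n :: "'v \<Rightarrow> nat" where "x = (\<Sum>\<alpha>\<in>S. scale (of_nat (m \<alpha>)) \<alpha>)"
    and "y = (\<Sum>\<alpha>\<in>S. scale (of_nat (n \<alpha>)) \<alpha>)"
    using assms by (auto simp: nonneg_cone_def)
  then have "x + y = (\<Sum>\<alpha>\<in>S. scale (of_nat (m \<alpha> + n \<alpha>)) \<alpha>)"
    by (simp add: sum.distrib scale_left_distrib)
  then show ?thesis
    unfolding nonneg_cone_def mem_Collect_eq by (intro exI conjI TrueI)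
qed

lemma zero_in_nonneg_cone: "0 \<in> nonneg_cone S"
  unfolding nonneg_cone_def by (auto intro!: exI[of _ "\<lambda>_. 0"])

definition affine_cone :: "'v affine set"
  where "affine_cone = {(v, k, l) | v k l. l = 0 \<and> (k > 0 \<or> k = 0 \<and> v \<in> nonneg_cone \<Pi>)}"

lemma affine_cone_add: "x \<in> affine_cone \<Longrightarrow> y \<in> affine_cone \<Longrightarrow> x + y \<in> affine_cone"
  by (auto simp: affine_cone_def nonneg_cone_add)

lemma affine_pos_roots_cone: "affine_pos_roots = affine_roots \<inter> affine_cone"
  by (force simp: affine_pos_root_iff affine_root_iff affine_cone_def)

lemma affine_weyl_pos:
  assumes w: "w \<in> affine_weyl_group" and pos: "\<And>\<alpha>. \<alpha> \<in> \<Pi> \<Longrightarrow> w (fin \<alpha>) \<in> affine_pos_roots"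
    and \<beta>: "\<beta> \<in> pos_roots"
  shows "w (fin \<beta>) \<in> affine_pos_roots"
proof -
  have w0: "w 0 = 0"
    using affine_weyl_add[OF w, of 0 0] by simp
  have zero: "(0 :: 'v affine) \<in> affine_cone"
    by (simp add: affine_cone_def zero_prod_def zero_in_nonneg_cone)
  have fin_add: "fin (x + y) = fin x + fin y" for x y :: 'v
    by (simp add: fin_def)
  have fin_0: "fin 0 = (0 :: 'v affine)"
    by (simp add: fin_def zero_prod_def)
  have mult: "w (fin (scale (of_nat n) \<alpha>)) \<in> affine_cone" if "\<alpha> \<in> \<Pi>" for n \<alpha>
  proof (induction n)
    case 0
    show ?case using w0 zero fin_0 by simp
  next
    case (Suc n)
    have "w (fin \<alpha>) \<in> affine_cone"
      using pos[OF that] affine_pos_roots_cone by blast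
    with Suc show ?case
      by (simp add: scale_left_distrib fin_add affine_weyl_add[OF w] affine_cone_add)
  qed
  have "finite \<Pi>"
    using simple_roots_subset finite_roots finite_subset by blast
  have "w (fin (\<Sum>\<alpha>\<in>S. scale (of_nat (n \<alpha>)) \<alpha>)) \<in> affine_cone" if "S \<subseteq> \<Pi>"
    for S and n :: "'v \<Rightarrow> nat"
    using finite_subset[OF that \<open>finite \<Pi>\<close>] that
    by (induction S rule: finite_induct)
      (auto simp: w0 zero fin_0 fin_add affine_weyl_add[OF w] intro!: affine_cone_add mult)
  then have "w (fin \<beta>) \<in> affine_cone"
    using \<beta> by (auto simp: pos_roots_def nonneg_cone_def)
  moreover have "fin \<beta> \<in> affine_roots"
    using \<beta> by (auto simp: pos_roots_def affine_root_iff fin_def intro: exI[of _ "0::int"])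
  ultimately show ?thesis
    using affine_weyl_root[OF w] affine_pos_roots_cone by blast
qed

text \<open>
  The set attached to an admissible element is indeed an ad-nilpotent ideal, so it makes sense to
  speak of its generators.
\<close>

lemma ad_nilpotent_ideal_of:
  assumes "admissible w"
  shows "ad_nilpotent_ideal (ideal_of w)"
  unfolding ad_nilpotent_ideal_def
proof (intro conjI ballI impI)
  show "ideal_of w \<subseteq> pos_roots"
    by (auto simp: ideal_of_def)
next
  fix \<gamma> \<nu>
  assume \<gamma>: "\<gamma> \<in> ideal_of w" and \<nu>: "\<nu> \<in> pos_roots" and root: "\<gamma> + \<nu> \<in> \<Delta>"
  have w: "w \<in> affine_weyl_group"
    using assms by (simp add: admissible_def)
  have pos: "\<gamma> + \<nu> \<in> pos_roots"
    using \<gamma> \<nu> root nonneg_cone_add by (auto simp: ideal_of_def pos_roots_def)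
  have aff: "\<delta> - fin (\<gamma> + \<nu>) \<in> affine_pos_roots"
    using uminus_root[OF root]
    by (auto simp: affine_pos_root_iff \<delta>_def fin_def intro!: exI[of _ "1::int"])
  obtain y where "y \<in> affine_pos_roots" and "w (\<delta> - fin \<gamma>) = - y"
    using \<gamma> unfolding ideal_of_def inversions_def by blast
  then have "- w (\<delta> - fin \<gamma>) \<in> affine_cone"
    by (simp add: affine_pos_roots_cone)
  moreover have "w (fin \<nu>) \<in> affine_cone"
    using affine_weyl_pos[OF w _ \<nu>] assms unfolding admissible_def affine_pos_roots_cone by blast
  moreover have "w (\<delta> - fin \<gamma>) = w (\<delta> - fin (\<gamma> + \<nu>)) + w (fin \<nu>)"
    using affine_weyl_add[OF w, of "\<delta> - fin (\<gamma> + \<nu>)" "fin \<nu>"]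
    by (simp add: fin_def \<delta>_def)
  ultimately have "- w (\<delta> - fin (\<gamma> + \<nu>)) \<in> affine_cone"
    using affine_cone_add[of "- w (\<delta> - fin \<gamma>)" "w (fin \<nu>)"] by simp
  moreover have "w (\<delta> - fin (\<gamma> + \<nu>)) \<in> affine_roots"
    using affine_weyl_root[OF w] aff affine_pos_roots_cone by blast
  then have "- w (\<delta> - fin (\<gamma> + \<nu>)) \<in> affine_roots"
    unfolding affine_root_iff using uminus_root
    by (auto, metis of_int_minus)
  ultimately have "- w (\<delta> - fin (\<gamma> + \<nu>)) \<in> affine_pos_roots"
    using affine_pos_roots_cone by blast
  then have "w (\<delta> - fin (\<gamma> + \<nu>)) \<in> uminus ` affine_pos_roots"
    by (metis image_eqI minus_minus)
  with aff pos show "\<gamma> + \<nu> \<in> ideal_of w"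
    by (simp add: ideal_of_def inversions_def)
qed

end

end

theory Submission
  imports Defs
begin

text \<open>
  Let \<open>f x\<close> be the coefficient of \<open>\<delta>\<close> in \<open>w\<^sup>-\<^sup>1 x\<close>. For \<open>\<gamma> \<in> I\<close> the positive root
  \<open>\<beta> = w (\<gamma> - \<delta>)\<close> has \<open>f \<beta> = -1\<close>, and admissibility says that \<open>f\<close> is at least \<open>-1\<close> on simple roots.
  If \<open>\<gamma> = \<gamma>' + \<nu>\<close> with \<open>\<gamma>' \<in> I\<close>, then \<open>\<beta> = w (\<gamma>' - \<delta>) + w \<nu>\<close> has height at least two, so it is not
  simple. Conversely, induction on the height shows that a non-simple positive root \<open>\<beta>\<close> with
  \<open>f \<beta> \<le> -1\<close> is a sum of two positive roots, one of which has \<open>f = -1\<close>; for \<open>f \<beta> = -1\<close> the other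
  one has \<open>f = 0\<close>, and applying \<open>w\<^sup>-\<^sup>1\<close> exhibits \<open>\<gamma>\<close> as the sum of an element of \<open>I\<close> and a
  positive root.
\<close>

context based_root_system
begin

section \<open>Bilinearity and sums of finite roots\<close>

lemma form_add_right: "form x (y + z) = form x y + form x z"
  using form_add_left form_commute by metis

lemma form_minus_right: "form x (- y) = - form x y"
  using form_minus_left form_commute by metis

lemma form_scale_right: "form x (scale c y) = c * form x y"
  using form_scale_left form_commute by metis

lemma form_sum_right: "form x (\<Sum>a\<in>A. g a) = (\<Sum>a\<in>A. form x (g a))"
proof -
  have "form x 0 = 0"
    using form_add_right[of x 0 0] by simp
  then show ?thesis
    by (induction A rule: infinite_finite_induct) (simp_all add: form_add_right)
qed

lemma root_form_pos: "\<alpha> \<in> \<Delta> \<Longrightarrow> 0 < form \<alpha> \<alpha>"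
  using form_pos zero_not_root by metis

text \<open>If \<open>a + b\<close> were neither a root nor zero, neither Cartan integer of the pair
  could be -1, since the corresponding reflection would yield \<open>a + b\<close>. Both are then at
  most -2, and adding the two resulting bounds contradicts positive definiteness at
  \<open>a + b\<close>.\<close>

lemma root_add:
  assumes a: "a \<in> \<Delta>" and b: "b \<in> \<Delta>" and neg: "form a b < 0"
  shows "a + b \<in> \<Delta> \<or> a + b = 0"
proof (rule ccontr)
  assume not: "\<not> (a + b \<in> \<Delta> \<or> a + b = 0)"
  have bound: "form x y \<le> - form y y"
    if x: "x \<in> \<Delta>" and y: "y \<in> \<Delta>" and xy: "form x y < 0" "x + y \<notin> \<Delta>" for x y
  proof -
    have pos: "0 < form y y"
      using y by (rule root_form_pos)
    obtain p where p: "2 * form x y / form y y = of_int p"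
      using crystallographic[OF y x] by (auto elim: Ints_cases)
    have "p \<noteq> - 1"
      using reflect_root[OF y x] p xy(2) by auto
    moreover have "(of_int p :: rat) < 0"
      unfolding p[symmetric] using pos xy(1) by (simp add: divide_less_0_iff)
    ultimately have "p \<le> - 2"
      by simp
    then have "2 * form x y / form y y \<le> - 2"
      unfolding p by (metis of_int_le_iff of_int_minus of_int_numeral)
    then show ?thesis
      using pos by (simp add: field_simps)
  qed
  have "form a b \<le> - form b b" "form b a \<le> - form a a"
    using bound[OF a b] bound[OF b a] neg not by (simp_all add: form_commute add.commute)
  then have "form (a + b) (a + b) \<le> 0"
    by (simp add: form_add_left form_add_right form_commute)
  then show False
    using not form_pos[of "a + b"] by force
qed

lemma root_diff:
  assumes "a \<in> \<Delta>" and "b \<in> \<Delta>" and "0 < form a b"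
  shows "a - b \<in> \<Delta> \<or> a - b = 0"
  using root_add[of a "- b"] assms uminus_root by (simp add: form_minus_right)

text \<open>Root-level counterpart of the Jacobi identity: a third root can be absorbed into one of
  two summands, up to cancellation. If this failed, \<open>a\<close> and \<open>b\<close> would pair
  nonnegatively with \<open>c\<close> and nonpositively with \<open>a + b + c\<close>, which forces
  \<open>form (a + b) (a + b) \<le> 0\<close>.\<close>

lemma root_sum_three:
  assumes a: "a \<in> \<Delta>" and b: "b \<in> \<Delta>" and c: "c \<in> \<Delta>" and ab: "a + b \<in> \<Delta>" and abc: "a + b + c \<in> \<Delta>"
  shows "a + c \<in> \<Delta> \<or> a + c = 0 \<or> b + c \<in> \<Delta> \<or> b + c = 0"
proof (rule ccontr)
  assume "\<not> ?thesis"
  then have "\<not> form a c < 0" "\<not> form b c < 0"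
      "\<not> 0 < form (a + b + c) a" "\<not> 0 < form (a + b + c) b"
    using root_add[OF a c] root_add[OF b c] root_diff[OF abc a] root_diff[OF abc b]
    by (auto simp: algebra_simps)
  moreover have "0 < form (a + b) (a + b)"
    using ab by (rule root_form_pos)
  ultimately show False
    by (simp add: form_add_left form_add_right form_commute)
qed

section \<open>Heights of finite and affine roots\<close>

lemma finite_simple_roots: "finite \<Pi>"
  using simple_roots_subset finite_roots finite_subset by blast

lemma nonneg_cone_subset_span: "nonneg_cone S \<subseteq> span S"
  unfolding nonneg_cone_def by (auto intro!: span_sum intro: span_scale span_base)

lemma span_simple_roots: "span \<Pi> = UNIV"
proof -
  have "\<Delta> \<subseteq> span \<Pi>"
    using root_pos_or_neg nonneg_cone_subset_span[of \<Pi>] span_neg by (metis minus_minus subset_iff)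
  then have "span \<Delta> \<subseteq> span \<Pi>"
    by (simp add: span_minimal)
  then show ?thesis
    using roots_span by blast
qed

text \<open>Coordinates in the basis \<Pi> make this additive on all of V, not only on the cone, so
  that differences of roots can be measured as well.\<close>

definition height :: "'v \<Rightarrow> rat"
  where "height v = (\<Sum>\<alpha>\<in>\<Pi>. representation \<Pi> v \<alpha>)"

lemma height_add: "height (x + y) = height x + height y"
  by (simp add: height_def representation_add simple_roots_independent span_simple_roots
      sum.distrib)

lemma height_minus: "height (- x) = - height x"
  using height_add[of x "- x"] height_add[of 0 0] by simp

lemma height_simple: "\<alpha> \<in> \<Pi> \<Longrightarrow> height \<alpha> = 1"
  by (simp add: height_def representation_basis simple_roots_independent finite_simple_roots)

lemma height_nonneg_cone:
  assumes "x \<in> nonneg_cone \<Pi>"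
  shows "x = 0 \<or> 1 \<le> height x"
proof -
  obtain n :: "'v \<Rightarrow> nat" where x: "x = (\<Sum>\<alpha>\<in>\<Pi>. scale (of_nat (n \<alpha>)) \<alpha>)"
    using assms by (auto simp: nonneg_cone_def)
  have "height x = (\<Sum>\<alpha>\<in>\<Pi>. of_nat (n \<alpha>))"
  proof -
    have h0: "height 0 = 0"
      using height_add[of 0 0] by simp
    have scale: "height (scale (of_nat m) \<alpha>) = of_nat m * height \<alpha>" for m \<alpha>
      by (induction m) (simp_all add: h0 height_add scale_left_distrib distrib_right)
    have "height (\<Sum>\<alpha>\<in>S. scale (of_nat (n \<alpha>)) \<alpha>) = (\<Sum>\<alpha>\<in>S. of_nat (n \<alpha>))" if "S \<subseteq> \<Pi>" for S
      using finite_subset[OF that finite_simple_roots] that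
      by (induction S rule: finite_induct) (auto simp: h0 height_add scale height_simple)
    then show ?thesis
      using x by simp
  qed
  then have h: "height x = of_nat (\<Sum>\<alpha>\<in>\<Pi>. n \<alpha>)"
    by simp
  show ?thesis
  proof (cases "(\<Sum>\<alpha>\<in>\<Pi>. n \<alpha>) = 0")
    case True
    then have "x = 0"
      unfolding x using finite_simple_roots by (intro sum.neutral) simp
    then show ?thesis ..
  next
    case False
    then show ?thesis
      unfolding h by (metis Suc_leI neq0_conv of_nat_1 of_nat_mono One_nat_def)
  qed
qed

lemma form_nonneg_cone_le:
  assumes "x \<in> nonneg_cone \<Pi>" and "\<And>\<alpha>. \<alpha> \<in> \<Pi> \<Longrightarrow> form v \<alpha> \<le> 0"
  shows "form v x \<le> 0"
  using assms by (auto simp: nonneg_cone_def form_sum_right form_scale_right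
      intro!: sum_nonpos mult_nonneg_nonpos)

text \<open>Positivity of \<theta> is extracted from its maximality: comparison with the root
  \<open>- \<theta>\<close> puts twice \<theta> in the cone, so \<open>- \<theta>\<close> cannot lie
  there.\<close>

lemma height_highest: "1 \<le> height \<theta>"
proof -
  have "\<theta> \<noteq> 0"
    using highest_root_root zero_not_root by metis
  moreover have "\<theta> \<in> nonneg_cone \<Pi>"
  proof (rule ccontr)
    assume "\<theta> \<notin> nonneg_cone \<Pi>"
    then have "1 \<le> height (- \<theta>)"
      using root_pos_or_neg[OF highest_root_root] height_nonneg_cone[of "- \<theta>"] \<open>\<theta> \<noteq> 0\<close> by auto
    moreover have "\<theta> - - \<theta> = 0 \<or> 1 \<le> height (\<theta> - - \<theta>)"
      using highest_root_max[OF uminus_root[OF highest_root_root]] by (rule height_nonneg_cone)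
    ultimately show False
      using height_add[of \<theta> \<theta>] height_add[of 0 0] by (auto simp: height_minus)
  qed
  ultimately show ?thesis
    using height_nonneg_cone by blast
qed

text \<open>The weight \<open>height \<theta> + 1\<close> of \<delta> is the Coxeter number; it
  gives \<open>\<delta> - fin \<theta>\<close> height 1, like the other simple roots.\<close>

definition affine_height :: "'v affine \<Rightarrow> rat"
  where "affine_height x = height (fst x) + fst (snd x) * (height \<theta> + 1)"

lemma affine_height_add: "affine_height (x + y) = affine_height x + affine_height y"
  by (simp add: affine_height_def height_add algebra_simps)

lemma affine_height_simple: "a \<in> affine_simple_roots \<Longrightarrow> affine_height a = 1"
  by (auto simp: affine_simple_roots_def affine_height_def fin_def \<delta>_def height_simple height_minus)

text \<open>For \<open>k \<ge> 1\<close>: as \<open>- \<beta>\<close> is a root too, maximality of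
  \<theta> bounds \<open>height \<beta>\<close> below by \<open>- height \<theta>\<close>, and the
  contribution of \<delta> outweighs this by at least 1.\<close>

lemma affine_height_pos:
  assumes "x \<in> affine_pos_roots"
  shows "1 \<le> affine_height x"
proof -
  obtain \<beta> k where x: "\<beta> \<in> \<Delta>" "x = (\<beta>, of_int k, 0)" "k \<ge> 1 \<or> k = 0 \<and> \<beta> \<in> nonneg_cone \<Pi>"
    using assms affine_pos_root_iff by blast
  have "\<beta> \<noteq> 0"
    using x(1) zero_not_root by metis
  show ?thesis
  proof (cases "k \<ge> 1")
    case True
    have "\<theta> + \<beta> \<in> nonneg_cone \<Pi>"
      using highest_root_max[OF uminus_root[OF x(1)]] by simp
    then have "0 \<le> height (\<theta> + \<beta>)"
      using height_nonneg_cone height_add[of 0 0] by fastforce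
    moreover have "1 * (height \<theta> + 1) \<le> of_int k * (height \<theta> + 1)"
      using True height_highest by (intro mult_right_mono) simp_all
    ultimately show ?thesis
      by (simp add: affine_height_def x(2) height_add)
  next
    case False
    then show ?thesis
      using x height_nonneg_cone[of \<beta>] \<open>\<beta> \<noteq> 0\<close> by (simp add: affine_height_def)
  qed
qed

section \<open>Signs and sums of affine roots\<close>

lemma affine_pos_roots_subset: "x \<in> affine_pos_roots \<Longrightarrow> x \<in> affine_roots"
  by (simp add: affine_pos_roots_cone)

lemma uminus_affine_root: "x \<in> affine_roots \<Longrightarrow> - x \<in> affine_roots"
  unfolding affine_root_iff using uminus_root by (auto, metis of_int_minus)

lemma affine_root_pos_or_neg:
  assumes "x \<in> affine_roots"
  shows "x \<in> affine_pos_roots \<or> - x \<in> affine_pos_roots"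
proof -
  obtain \<beta> k where x: "\<beta> \<in> \<Delta>" "x = (\<beta>, of_int k, 0)"
    using assms affine_root_iff by blast
  consider "k \<ge> 1" | "k = 0" | "- k \<ge> 1"
    by linarith
  then show ?thesis
  proof cases
    case 1
    then show ?thesis
      using x affine_pos_root_iff by blast
  next
    case 2
    then show ?thesis
      using x root_pos_or_neg[OF x(1)] uminus_affine_root[OF assms] assms
      by (auto simp: affine_pos_roots_cone affine_cone_def)
  next
    case 3
    then have "- x \<in> affine_cone"
      using x by (simp add: affine_cone_def)
    then show ?thesis
      using uminus_affine_root[OF assms] by (simp add: affine_pos_roots_cone)
  qed
qed

lemma affine_pos_root_not_neg: "x \<in> affine_pos_roots \<Longrightarrow> - x \<notin> affine_pos_roots"
  using affine_height_pos[of x] affine_height_pos[of "- x"] affine_height_add[of x "- x"]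
    affine_height_add[of 0 0] by auto

lemma fst_affine_root: "x \<in> affine_roots \<Longrightarrow> fst x \<in> \<Delta>"
  by (auto simp: affine_root_iff)

lemma affine_root_add:
  assumes "x \<in> affine_roots" and "y \<in> affine_roots" and "fst x + fst y \<in> \<Delta>"
  shows "x + y \<in> affine_roots"
  using assms by (auto simp: affine_root_iff simp flip: of_int_add)

text \<open>A multiple of \<delta> is not in \<open>affine_roots\<close>, so this degenerate case
  has to be treated apart in the arguments below.\<close>

lemma affine_root_add_imaginary:
  assumes "x \<in> affine_roots" and "y \<in> affine_roots" and "fst x + fst y = 0"
  obtains m :: int where "x + y = (0, of_int m, 0)"
  using assms that by (auto simp: affine_root_iff simp flip: of_int_add)

lemma affine_pos_root_add:
  assumes "x \<in> affine_pos_roots" and "y \<in> affine_pos_roots" and "fst x + fst y \<in> \<Delta>"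
  shows "x + y \<in> affine_pos_roots"
  using assms affine_root_add affine_cone_add by (auto simp: affine_pos_roots_cone)

lemma affine_height_imaginary:
  "0 \<le> affine_height (0, of_int m, 0) \<longleftrightarrow> 0 \<le> m" "0 < affine_height (0, of_int m, 0) \<longleftrightarrow> 0 < m"
  using height_highest height_add[of 0 0]
  by (auto simp: affine_height_def zero_le_mult_iff zero_less_mult_iff)

section \<open>Splitting positive affine roots\<close>

lemma affine_simple_root_pos:
  assumes "a \<in> affine_simple_roots"
  shows "a \<in> affine_pos_roots"
proof (rule ccontr)
  assume "a \<notin> affine_pos_roots"
  then have "- a \<in> affine_pos_roots"
    using assms affine_simple_roots_subset affine_root_pos_or_neg by blast
  then show False
    using affine_height_pos[of "- a"] affine_height_simple[OF assms] affine_height_add[of a "- a"]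
      affine_height_add[of 0 0] by simp
qed

text \<open>Some simple root pairs positively with \<beta>: otherwise pairing with
  \<open>\<theta> + \<beta>\<close>, which lies in the cone, gives
  \<open>form \<beta> \<beta> \<le> 0\<close>. Subtracting that simple root leaves a root or a
  multiple of \<delta>, whose sign is read off from its height.\<close>

lemma simple_root_subtract:
  assumes x: "x \<in> affine_pos_roots" and nonsimple: "x \<notin> affine_simple_roots"
  obtains a where "a \<in> affine_simple_roots" "x - a \<in> affine_pos_roots"
    | a m where "a \<in> affine_simple_roots" "x - a = (0, of_int m, 0)" "0 < m"
proof -
  obtain \<beta> k where \<beta>: "\<beta> \<in> \<Delta>" "x = (\<beta>, of_int k, 0)" "k \<ge> 1 \<or> k = 0 \<and> \<beta> \<in> nonneg_cone \<Pi>"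
    using x affine_pos_root_iff by blast
  have "\<exists>a\<in>affine_simple_roots. 0 < form \<beta> (fst a)"
  proof (rule ccontr)
    assume "\<not> ?thesis"
    then have nonpos: "form \<beta> (- \<theta>) \<le> 0" "\<And>\<alpha>. \<alpha> \<in> \<Pi> \<Longrightarrow> form \<beta> \<alpha> \<le> 0"
      by (auto simp: affine_simple_roots_def fin_def \<delta>_def not_less)
    have "\<theta> + \<beta> \<in> nonneg_cone \<Pi>"
      using highest_root_max[OF uminus_root[OF \<beta>(1)]] by simp
    then have "form \<beta> \<beta> \<le> 0"
      using \<beta>(3) form_nonneg_cone_le[OF _ nonpos(2), of "\<theta> + \<beta>"]
        form_nonneg_cone_le[OF _ nonpos(2), of \<beta>] nonpos(1)
      by (auto simp: form_add_right form_minus_right)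
    then show False
      using root_form_pos[OF \<beta>(1)] by simp
  qed
  then obtain a where a: "a \<in> affine_simple_roots" "0 < form \<beta> (fst a)"
    by blast
  have a_root: "- a \<in> affine_roots" "a \<in> affine_roots"
    using a(1) affine_simple_roots_subset uminus_affine_root by blast+
  have nonneg: "0 \<le> affine_height (x - a)"
    using affine_height_pos[OF x] affine_height_simple[OF a(1)] affine_height_add[of "x - a" a]
    by simp
  have "fst x + fst (- a) \<in> \<Delta> \<or> fst x + fst (- a) = 0"
    using root_diff[OF \<beta>(1) fst_affine_root[OF a_root(2)] a(2)] \<beta>(2) by simp
  then show ?thesis
  proof
    assume "fst x + fst (- a) \<in> \<Delta>"
    then have "x - a \<in> affine_roots"
      using affine_root_add[OF affine_pos_roots_subset[OF x] a_root(1)] by simp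
    moreover have "- (x - a) \<notin> affine_pos_roots"
      using nonneg affine_height_pos[of "- (x - a)"] affine_height_add[of "x - a" "- (x - a)"]
        affine_height_add[of 0 0] by auto
    ultimately show ?thesis
      using affine_root_pos_or_neg that(1)[OF a(1)] by blast
  next
    assume "fst x + fst (- a) = 0"
    then obtain m where m: "x - a = (0, of_int m, 0)"
      using affine_root_add_imaginary[OF affine_pos_roots_subset[OF x] a_root(1)] by auto
    moreover have "m \<noteq> 0"
      using m nonsimple a(1) by (auto simp: zero_prod_def[symmetric])
    moreover have "0 \<le> m"
      using nonneg m affine_height_imaginary(1) by simp
    ultimately show ?thesis
      using that(2)[OF a(1) m] by simp
  qed
qed

text \<open>Levels \<open>f x\<close> below -1 are included because the roots split during the
  induction may have lower level than the original one. A simple root is split off first; if its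
  level is not -1, the pieces are regrouped until one has that level.\<close>

lemma level_decomposition:
  fixes f :: "'v affine \<Rightarrow> rat"
  assumes f_add: "\<And>x y. f (x + y) = f x + f y"
    and f_imaginary: "\<And>m. f (0, of_int m, 0) = of_int m"
    and f_int: "\<And>x. x \<in> affine_roots \<Longrightarrow> f x \<in> \<int>"
    and f_simple: "\<And>a. a \<in> affine_simple_roots \<Longrightarrow> - 1 \<le> f a"
    and x: "x \<in> affine_pos_roots" "x \<notin> affine_simple_roots" "f x \<le> - 1"
  shows "\<exists>y\<in>affine_pos_roots. \<exists>z\<in>affine_pos_roots. x = y + z \<and> f y = - 1"
proof -
  obtain n :: nat where "affine_height x < of_nat n"
    using reals_Archimedean2 by blast
  then show ?thesis
    using x
  proof (induction n arbitrary: x)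
    case 0
    then show ?case
      using affine_height_pos[of x] by simp
  next
    case (Suc n)
    note x = Suc.prems(2-4)
    \<comment> \<open>Level at most -2 already excludes simple roots, whose level is at least
      -1.\<close>
    have IH: "\<exists>y\<in>affine_pos_roots. \<exists>z\<in>affine_pos_roots. \<xi> = y + z \<and> f y = - 1"
      if "\<xi> \<in> affine_pos_roots" "f \<xi> \<le> - 2" "affine_height \<xi> \<le> affine_height x - 1" for \<xi>
    proof (rule Suc.IH)
      show "\<xi> \<notin> affine_simple_roots"
        using that(2) f_simple[of \<xi>] by auto
    qed (use that Suc.prems in auto)
    \<comment> \<open>Given \<open>x = \<xi> + \<rho>\<close>, split \<open>\<xi> = \<kappa>\<^sub>1 + \<kappa>\<^sub>2\<close> by the induction hypothesis and absorb \<open>\<rho>\<close> into one of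
      the parts: into \<open>\<kappa>\<^sub>2\<close> this finishes, into \<open>\<kappa>\<^sub>1\<close> it lowers the level of \<open>\<rho>\<close> by one.\<close>
    have step: ?case
      if "\<xi> \<in> affine_pos_roots" "\<rho> \<in> affine_pos_roots" "x = \<xi> + \<rho>" "f \<rho> = of_nat r" for r \<xi> \<rho>
      using that
    proof (induction r arbitrary: \<xi> \<rho> rule: less_induct)
      case (less r)
      note \<xi> = less.prems(1) and \<rho> = less.prems(2) and sum = less.prems(3) and lev = less.prems(4)
      show ?case
      proof (cases "f \<xi> = - 1")
        case True
        then show ?thesis
          using \<xi> \<rho> sum by blast
      next
        case False
        have f\<xi>: "f \<xi> = f x - of_nat r"
          using sum lev f_add by simp
        \<comment> \<open>Integrality turns \<open>f \<xi> \<le> - 1\<close> and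
          \<open>f \<xi> \<noteq> - 1\<close> into \<open>f \<xi> \<le> - 2\<close>, the range in
          which \<open>IH\<close> splits \<xi>.\<close>
        obtain q where q: "f \<xi> = of_int q"
          using f_int[OF affine_pos_roots_subset[OF \<xi>]] by (auto elim: Ints_cases)
        have "f \<xi> \<le> - 1"
          using f\<xi> x(3) of_nat_0_le_iff[of r] by linarith
        then have "q \<le> - 1" "q \<noteq> - 1"
          using False unfolding q by (metis of_int_1 of_int_le_iff of_int_minus, auto)
        then have "q \<le> - 2"
          by simp
        then have "f \<xi> \<le> - 2"
          unfolding q by (metis of_int_le_iff of_int_minus of_int_numeral)
        moreover have "affine_height \<xi> \<le> affine_height x - 1"
          using sum affine_height_add affine_height_pos[OF \<rho>] by simp
        ultimately obtain \<kappa>\<^sub>1 \<kappa>\<^sub>2 where \<kappa>: "\<kappa>\<^sub>1 \<in> affine_pos_roots" "\<kappa>\<^sub>2 \<in> affine_pos_roots"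
            "\<xi> = \<kappa>\<^sub>1 + \<kappa>\<^sub>2" "f \<kappa>\<^sub>1 = - 1"
          using IH[OF \<xi>] by blast
        have f\<kappa>: "f \<kappa>\<^sub>2 = f x - of_nat r + 1"
          using \<kappa> f_add f\<xi> by simp
        note root = fst_affine_root[OF affine_pos_roots_subset]
        have "fst \<kappa>\<^sub>1 + fst \<kappa>\<^sub>2 \<in> \<Delta>" "fst \<kappa>\<^sub>1 + fst \<kappa>\<^sub>2 + fst \<rho> \<in> \<Delta>"
          using root[OF \<xi>] root[OF x(1)] sum \<kappa>(3) by simp_all
        from root_sum_three[OF root[OF \<kappa>(1)] root[OF \<kappa>(2)] root[OF \<rho>] this]
        consider "fst \<kappa>\<^sub>1 + fst \<rho> \<in> \<Delta>" | "fst \<kappa>\<^sub>1 + fst \<rho> = 0" | "fst \<kappa>\<^sub>2 + fst \<rho> \<in> \<Delta>" | "fst \<kappa>\<^sub>2 + fst \<rho> = 0"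
          by blast
        then show ?thesis
        proof cases
          case 1
          then have pos: "\<kappa>\<^sub>1 + \<rho> \<in> affine_pos_roots"
            using \<kappa>(1) \<rho> affine_pos_root_add by blast
          have eq: "x = \<kappa>\<^sub>2 + (\<kappa>\<^sub>1 + \<rho>)"
            using sum \<kappa>(3) by (simp add: ac_simps)
          show ?thesis
          \<comment> \<open>At \<open>r = 0\<close> the root
            \<open>\<kappa>\<^sub>1 + \<rho>\<close> itself has level -1 and becomes the wanted
            part. For larger \<open>r\<close> its level \<open>r - 1\<close> is still a natural
            number, and the inner induction continues with \<open>\<kappa>\<^sub>2\<close> in the
            role of \<xi>.\<close>
          proof (cases r)
            case 0
            then have "f (\<kappa>\<^sub>1 + \<rho>) = - 1"
              using f_add \<kappa>(4) lev by simp
            then show ?thesis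
              using pos \<kappa>(2) eq add.commute by metis
          next
            case (Suc r')
            then have "f (\<kappa>\<^sub>1 + \<rho>) = of_nat r'"
              using f_add \<kappa>(4) lev by simp
            then show ?thesis
              using less.IH[OF _ \<kappa>(2) pos eq, of r'] Suc by simp
          qed
        next
          \<comment> \<open>Here \<open>x\<close> is \<open>\<kappa>\<^sub>2\<close> plus a positive
            multiple of \<delta>, so \<open>\<kappa>\<^sub>2\<close> has level at most -2 and splits
            again. The multiple of \<delta> is absorbed into the second part, which keeps its finite
            root and stays positive.\<close>
          case 2
          then obtain m where m: "\<kappa>\<^sub>1 + \<rho> = (0, of_int m, 0)"
            using affine_root_add_imaginary[OF \<kappa>(1)[THEN affine_pos_roots_subset]
                \<rho>[THEN affine_pos_roots_subset]] by blast
          have eq: "x = \<kappa>\<^sub>2 + (0, of_int m, 0)"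
            using sum \<kappa>(3) m by (metis add.assoc add.commute)
          have "0 < affine_height (\<kappa>\<^sub>1 + \<rho>)"
            using affine_height_pos[OF \<kappa>(1)] affine_height_pos[OF \<rho>] affine_height_add by simp
          then have "0 < m"
            using m affine_height_imaginary(2) by simp
          then have m1: "1 \<le> (of_int m :: rat)" by simp
          have "f \<kappa>\<^sub>2 = f x - of_int m"
            using f_add[of \<kappa>\<^sub>2 "(0, of_int m, 0)"] eq f_imaginary by simp
          then have "f \<kappa>\<^sub>2 \<le> - 2"
            using m1 x(3) by linarith
          moreover have "affine_height \<kappa>\<^sub>2 \<le> affine_height x - 1"
            using sum \<kappa>(3) affine_height_add affine_height_pos[OF \<rho>] affine_height_pos[OF \<kappa>(1)]
            by simp
          ultimately obtain \<zeta>\<^sub>1 \<zeta>\<^sub>2 where \<zeta>: "\<zeta>\<^sub>1 \<in> affine_pos_roots" "\<zeta>\<^sub>2 \<in> affine_pos_roots"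
              "\<kappa>\<^sub>2 = \<zeta>\<^sub>1 + \<zeta>\<^sub>2" "f \<zeta>\<^sub>1 = - 1"
            using IH[OF \<kappa>(2)] by blast
          obtain \<beta> k where \<beta>: "\<beta> \<in> \<Delta>" "\<zeta>\<^sub>2 = (\<beta>, of_int k, 0)" "k \<ge> 1 \<or> k = 0 \<and> \<beta> \<in> nonneg_cone \<Pi>"
            using \<zeta>(2) affine_pos_root_iff by blast
          have "\<zeta>\<^sub>2 + (0, of_int m, 0) = (\<beta>, of_int (k + m), 0)" "k + m \<ge> 1"
            using \<beta> \<open>0 < m\<close> by auto
          then have "\<zeta>\<^sub>2 + (0, of_int m, 0) \<in> affine_pos_roots"
            using \<beta>(1) affine_pos_root_iff by blast
          moreover have "x = \<zeta>\<^sub>1 + (\<zeta>\<^sub>2 + (0, of_int m, 0))"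
            using eq \<zeta>(3) by (simp add: add.assoc)
          ultimately show ?thesis
            using \<zeta> by blast
        next
          case 3
          then have "\<kappa>\<^sub>2 + \<rho> \<in> affine_pos_roots"
            using \<kappa>(2) \<rho> affine_pos_root_add by blast
          moreover have "x = \<kappa>\<^sub>1 + (\<kappa>\<^sub>2 + \<rho>)"
            using sum \<kappa>(3) by (simp add: add.assoc)
          ultimately show ?thesis
            using \<kappa> by blast
        next
          \<comment> \<open>The height forces \<open>0 < m\<close>, whereas
            \<open>\<kappa>\<^sub>2 + \<rho>\<close> has level
            \<open>f x + 1 \<le> 0\<close>.\<close>
          case 4
          then obtain m where m: "\<kappa>\<^sub>2 + \<rho> = (0, of_int m, 0)"
            using affine_root_add_imaginary[OF \<kappa>(2)[THEN affine_pos_roots_subset]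
                \<rho>[THEN affine_pos_roots_subset]] by blast
          have "0 < affine_height (\<kappa>\<^sub>2 + \<rho>)"
            using affine_height_pos[OF \<kappa>(2)] affine_height_pos[OF \<rho>] affine_height_add by simp
          then have "0 < m"
            using m affine_height_imaginary(2) by simp
          moreover have "of_int m = f \<kappa>\<^sub>2 + f \<rho>"
            using f_add m f_imaginary by metis
          then have "(of_int m :: rat) \<le> 0"
            using f\<kappa> lev x(3) by simp
          ultimately show ?thesis by simp
        qed
      qed
    qed
    from x(1,2) show ?case
    proof (cases rule: simple_root_subtract)
      case (1 a)
      note sub = 1(2)
      have a: "a \<in> affine_pos_roots"
        using 1(1) by (rule affine_simple_root_pos)
      obtain q where q: "f a = of_int q"
        using f_int[OF affine_pos_roots_subset[OF a]] by (auto elim: Ints_cases)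
      have "- 1 \<le> q"
        using f_simple[OF 1(1)] unfolding q
        by (metis of_int_1 of_int_le_iff of_int_minus)
      \<comment> \<open>Level -1 finishes with \<open>a\<close> itself; otherwise the level is a
        natural number and \<open>step\<close> applies with \<open>a\<close> in the role of
        \<rho>.\<close>
      then consider "q = - 1" | "f a = of_nat (nat q)"
        using q by fastforce
      then show ?thesis
      proof cases
        case 1
        then have "f a = - 1"
          using q by simp
        then show ?thesis
          using a sub by (intro bexI[of _ a] bexI[of _ "x - a"]) simp_all
      next
        case 2
        then show ?thesis
          using step[OF sub a] by simp
      qed
    next
      \<comment> \<open>Exceeding a simple root by at least \<delta> would give \<open>x\<close>
        level at least 0.\<close>
      case (2 a m)
      have "f x = f (x - a) + f a"
        using f_add[of "x - a" a] by simp
      then have "f x = of_int m + f a"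
        using 2(2) f_imaginary by simp
      moreover have "(1 :: rat) \<le> of_int m"
        using 2(3) by simp
      ultimately show ?thesis
        using f_simple[OF 2(1)] x(3) by linarith
    qed
  qed
qed

section \<open>Action of the affine Weyl group and its inverses\<close>

lemma affine_weyl_surj_roots:
  assumes "w \<in> affine_weyl_group" and "x \<in> affine_roots"
  shows "\<exists>y\<in>affine_roots. w y = x"
  using assms
proof (induction arbitrary: x rule: affine_weyl_group.induct)
  case weyl_id
  then show ?case by auto
next
  case (weyl_step a w)
  have a: "a \<in> affine_roots"
    using weyl_step.hyps(1) affine_simple_roots_subset by blast
  obtain y where "y \<in> affine_roots" "w y = reflection a x"
    using weyl_step.IH[OF reflection_affine_root[OF a weyl_step.prems]] by blast
  then show ?case
    using reflection_involution[OF a, of x] by (intro bexI[of _ y]) simp_all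
qed

text \<open>The preimage constructed reflection by reflection is a root, and injectivity identifies
  it with \<open>inv w x\<close>.\<close>

lemma affine_weyl_inv_root:
  assumes "w \<in> affine_weyl_group" and "x \<in> affine_roots"
  shows "inv w x \<in> affine_roots"
  using affine_weyl_surj_roots[OF assms] bij_is_inj[OF affine_weyl_bij[OF assms(1)]]
  by (auto simp: inv_f_f)

text \<open>The \<lambda>-coordinate of a root vanishes, so \<delta> is orthogonal to all roots and
  every reflection fixes its multiples.\<close>

lemma affine_weyl_imaginary: "w \<in> affine_weyl_group \<Longrightarrow> w (0, q, 0) = (0, q, 0)"
proof (induction rule: affine_weyl_group.induct)
  case (weyl_step a w)
  then obtain \<alpha> k where a: "a = (\<alpha>, of_int k, 0)"
    using affine_simple_roots_subset affine_root_iff by blast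
  have "form 0 \<alpha> = 0"
    using form_add_left[of 0 0 \<alpha>] by simp
  then show ?case
    using weyl_step by (simp add: reflection_def a)
qed simp

lemma affine_weyl_minus: "w \<in> affine_weyl_group \<Longrightarrow> w (- x) = - w x"
  using affine_weyl_add[of w x "- x"] affine_weyl_add[of w 0 0] by (simp add: eq_neg_iff_add_eq_0 add.commute)

lemma affine_weyl_inv_add:
  assumes "w \<in> affine_weyl_group"
  shows "inv w (x + y) = inv w x + inv w y"
proof -
  have "w (inv w z) = z" "inv w (w z) = z" for z
    using affine_weyl_bij[OF assms] by (simp_all add: bij_is_surj bij_is_inj surj_f_inv_f)
  then show ?thesis
    using affine_weyl_add[OF assms] by metis
qed

section \<open>Generators and simple roots\<close>

lemma generator_iff_simple:
  assumes adm: "admissible w" and \<gamma>: "\<gamma> \<in> ideal_of w"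
  shows "is_generator (ideal_of w) \<gamma> \<longleftrightarrow> w (\<delta> - fin \<gamma>) \<in> uminus ` affine_simple_roots"
proof -
  have w: "w \<in> affine_weyl_group"
    using adm by (simp add: admissible_def)
  have w_pos: "w (fin \<nu>) \<in> affine_pos_roots" if "\<nu> \<in> pos_roots" for \<nu>
    using affine_weyl_pos[OF w _ that] adm by (simp add: admissible_def)
  have ideal: "- w (\<delta> - fin \<mu>) \<in> affine_pos_roots" if "\<mu> \<in> ideal_of w" for \<mu>
    using that by (auto simp: ideal_of_def inversions_def)
  have w_inv: "w (inv w z) = z" and inv_w: "inv w (w z) = z" for z
    using affine_weyl_bij[OF w] by (simp_all add: bij_is_surj bij_is_inj surj_f_inv_f)
  define \<beta> where "\<beta> = - w (\<delta> - fin \<gamma>)"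
  have \<beta>: "\<beta> \<in> affine_pos_roots"
    using ideal[OF \<gamma>] by (simp add: \<beta>_def)
  have \<beta>_split: "\<beta> = - w (\<delta> - fin (\<gamma> - \<nu>)) + w (fin \<nu>)" for \<nu>
    using affine_weyl_add[OF w, of "\<delta> - fin \<gamma>" "fin \<nu>"] by (simp add: \<beta>_def fin_def \<delta>_def)
  have inv_\<beta>: "inv w \<beta> = (\<gamma>, - 1, 0)"
    using inv_w[of "- (\<delta> - fin \<gamma>)"] affine_weyl_minus[OF w, of "\<delta> - fin \<gamma>"]
    by (simp add: \<beta>_def fin_def \<delta>_def)
  have "is_generator (ideal_of w) \<gamma> \<longleftrightarrow> \<beta> \<in> affine_simple_roots"
  proof
    assume simple: "\<beta> \<in> affine_simple_roots"
    have "\<gamma> - \<nu> \<notin> ideal_of w" if "\<nu> \<in> pos_roots" for \<nu>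
    proof
      assume "\<gamma> - \<nu> \<in> ideal_of w"
      then have "1 \<le> affine_height (- w (\<delta> - fin (\<gamma> - \<nu>)))" "1 \<le> affine_height (w (fin \<nu>))"
        using ideal w_pos[OF that] affine_height_pos by blast+
      then have "2 \<le> affine_height \<beta>"
        unfolding \<beta>_split[of \<nu>] affine_height_add by linarith
      then show False
        using affine_height_simple[OF simple] by simp
    qed
    then show "is_generator (ideal_of w) \<gamma>"
      using \<gamma> by (simp add: is_generator_def)
  next
    assume gen: "is_generator (ideal_of w) \<gamma>"
    show "\<beta> \<in> affine_simple_roots"
    proof (rule ccontr)
      assume nonsimple: "\<beta> \<notin> affine_simple_roots"
      define f where "f x = fst (snd (inv w x))" for x
      have inv_root: "\<exists>\<kappa> k. \<kappa> \<in> \<Delta> \<and> inv w x = (\<kappa>, of_int k, 0)" if "x \<in> affine_roots" for x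
        using affine_weyl_inv_root[OF w that] affine_root_iff by blast
      have f_add: "f (x + y) = f x + f y" for x y
        by (simp add: f_def affine_weyl_inv_add[OF w])
      have f_imaginary: "f (0, of_int m, 0) = of_int m" for m
        using inv_w[of "(0, of_int m, 0)"] affine_weyl_imaginary[OF w] by (simp add: f_def)
      have f_int: "f x \<in> \<int>" if "x \<in> affine_roots" for x
        using inv_root[OF that] by (auto simp: f_def)
      have f_simple: "- 1 \<le> f a" if a: "a \<in> affine_simple_roots" for a
      proof (cases "inv w a \<in> affine_pos_roots")
        case True
        then show ?thesis
          by (auto simp: f_def affine_pos_root_iff intro: order_trans[of _ 0])
      next
        case False
        have "a \<in> affine_roots"
          using a affine_simple_roots_subset by blast
        then have "- inv w a \<in> affine_pos_roots"
          using False affine_root_pos_or_neg[OF affine_weyl_inv_root[OF w]] by blast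
        then have "inv w a \<in> uminus ` affine_pos_roots"
          by (metis image_eqI minus_minus)
        \<comment> \<open>Condition (b) of admissibility: a negative preimage of a simple root has
          \<delta>-coefficient exactly -1.\<close>
        then obtain \<nu> where "inv w a = fin \<nu> - \<delta>"
          using adm a by (auto simp: admissible_def)
        then show ?thesis
          by (simp add: f_def fin_def \<delta>_def)
      qed
      have f\<beta>: "f \<beta> = - 1"
        by (simp add: f_def inv_\<beta>)
      obtain y z where yz: "y \<in> affine_pos_roots" "z \<in> affine_pos_roots" "\<beta> = y + z" "f y = - 1"
        using level_decomposition[of f \<beta>] f_add f_imaginary f_int f_simple \<beta> nonsimple f\<beta>
        by force
      have fz: "f z = 0"
        using f_add[of y z] yz(3,4) f\<beta> by simp
      \<comment> \<open>Levels -1 and 0 fix the \<delta>-coefficients of the two preimages; only the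
        signs of \<mu> and \<nu> remain to be settled.\<close>
      obtain \<mu> \<nu> where \<mu>: "\<mu> \<in> \<Delta>" "inv w y = fin \<mu> - \<delta>" and \<nu>: "\<nu> \<in> \<Delta>" "inv w z = fin \<nu>"
        using inv_root[OF affine_pos_roots_subset[OF yz(1)]]
          inv_root[OF affine_pos_roots_subset[OF yz(2)]] yz(4) fz
        by (auto simp: f_def fin_def \<delta>_def)
      have \<gamma>_sum: "\<gamma> = \<mu> + \<nu>"
        using inv_\<beta> affine_weyl_inv_add[OF w, of y z] yz(3) \<mu>(2) \<nu>(2) by (simp add: fin_def \<delta>_def)
      have wy: "w (\<delta> - fin \<mu>) = - y"
        using w_inv[of y] \<mu>(2) affine_weyl_minus[OF w, of "fin \<mu> - \<delta>"] by simp
      have fin_neg: "fin (- v) = - fin v" for v :: 'v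
        by (simp add: fin_def)
      have pos_or_neg: "v \<in> pos_roots \<or> - v \<in> pos_roots" if "v \<in> \<Delta>" for v
        using root_pos_or_neg[OF that] uminus_root[OF that] that by (simp add: pos_roots_def)
      \<comment> \<open>Otherwise \<open>w (fin (- \<nu>))\<close>, which equals \<open>- z\<close>,
        would be positive along with \<open>z\<close>.\<close>
      have "- \<nu> \<notin> pos_roots"
        using w_pos[of "- \<nu>"] affine_pos_root_not_neg[OF yz(2)] w_inv[of z] \<nu>(2)
        by (auto simp: fin_neg affine_weyl_minus[OF w])
      then have \<nu>_pos: "\<nu> \<in> pos_roots"
        using pos_or_neg[OF \<nu>(1)] by blast
      \<comment> \<open>Since \<open>w\<close> fixes \<delta>, a positive \<open>- \<mu>\<close>
        would place \<open>- y = \<delta> + w (fin (- \<mu>))\<close> in the cone, making both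
        \<open>y\<close> and \<open>- y\<close> positive.\<close>
      have "- \<mu> \<notin> pos_roots"
      proof
        assume "- \<mu> \<in> pos_roots"
        then have "w (fin (- \<mu>)) \<in> affine_cone"
          using w_pos affine_pos_roots_cone by blast
        moreover have "\<delta> \<in> affine_cone"
          by (simp add: affine_cone_def \<delta>_def)
        ultimately have "- y \<in> affine_cone"
          using affine_cone_add[of \<delta> "w (fin (- \<mu>))"] wy affine_weyl_imaginary[OF w, of 1]
            affine_weyl_add[OF w, of \<delta> "fin (- \<mu>)"] by (simp add: fin_neg \<delta>_def)
        then show False
          using uminus_affine_root affine_pos_root_not_neg[OF yz(1)] yz(1)
          by (simp add: affine_pos_roots_cone)
      qed
      then have \<mu>_pos: "\<mu> \<in> pos_roots"
        using pos_or_neg[OF \<mu>(1)] by blast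
      have "\<delta> - fin \<mu> = (- \<mu>, of_int 1, 0)"
        by (simp add: \<delta>_def fin_def)
      then have "\<delta> - fin \<mu> \<in> affine_pos_roots"
        using uminus_root[OF \<mu>(1)] affine_pos_root_iff by (metis order_refl)
      then have "\<mu> \<in> ideal_of w"
        using \<mu>_pos wy yz(1) by (simp add: ideal_of_def inversions_def)
      then show False
        using gen \<nu>_pos \<gamma>_sum by (auto simp: is_generator_def)
    qed
  qed
  also have "\<beta> \<in> affine_simple_roots \<longleftrightarrow> w (\<delta> - fin \<gamma>) \<in> uminus ` affine_simple_roots"
    unfolding \<beta>_def by (metis (no_types, opaque_lifting) imageE image_eqI minus_minus)
  finally show ?thesis .
qed

end

theorem theorem2p2:
  fixes scale :: "rat \<Rightarrow> 'v::ab_group_add \<Rightarrow> 'v"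
    and form :: "'v \<Rightarrow> 'v \<Rightarrow> rat"
    and \<Delta> \<Pi> :: "'v set"
    and \<theta> \<gamma> :: 'v
    and w :: "'v affine \<Rightarrow> 'v affine"
  assumes "based_root_system scale form \<Delta> \<Pi> \<theta>"
    and "based_root_system.admissible scale form \<Delta> \<Pi> \<theta> w"
    and "\<gamma> \<in> based_root_system.ideal_of scale \<Delta> \<Pi> w"
  shows "based_root_system.is_generator scale \<Delta> \<Pi> (based_root_system.ideal_of scale \<Delta> \<Pi> w) \<gamma>
    \<longleftrightarrow> w (\<delta> - fin \<gamma>) \<in> uminus ` based_root_system.affine_simple_roots \<Pi> \<theta>"
  using based_root_system.generator_iff_simple[OF assms] .

end
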